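(* For every integer $a>0$, the sequence $(\mathcal{G}(a,b))_{b\ge a}$ of Sprague-Grundy values of 2-Star Nim is ultimately additively periodic; that is, there exist integers $n_0\ge a$ and $p\ge 1$ such that $\mathcal{G}(a,b+p)=\mathcal{G}(a,b)+p$ for all $b\ge n_0$.
   Context: 2-Star Nim: a position is a pair $(a,b)$ of nonnegative integers, not both $0$ (one token on square $a$ of a first strip and one on square $b$ of a second strip, the two strips sharing their square $0$, which holds at most one token). A move replaces exactly one coordinate by a smaller nonnegative integer, provided the result is not $(0,0)$. A player unable to move loses. $\mathcal{G}(a,b)$ is the Sprague-Grundy value, $\mathcal{G}(p)=\operatorname{mex}\{\mathcal{G}(q): q\text{ reachable from }p\text{ in one move}\}$, where $\operatorname{mex}(S)$ is the least nonnegative integer not in $S$. *)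

theory Defs
  imports Main
begin

definition mex :: "nat set \<Rightarrow> nat" where
  "mex S = (LEAST n. n \<notin> S)"

text \<open>A pair \<open>(a, b)\<close> records the squares of the two tokens of 2-Star Nim. The pair \<open>(0, 0)\<close> is
  not a position; it is never the result of a move.\<close>

definition moves :: "nat \<times> nat \<Rightarrow> (nat \<times> nat) set" where
  "moves p = (case p of (a, b) \<Rightarrow>
     ({(a', b) | a'. a' < a} \<union> {(a, b') | b'. b' < b}) - {(0, 0)})"

lemma moves_less: "q \<in> moves p \<Longrightarrow> fst q + snd q < fst p + snd p"
  by (auto simp: moves_def split: prod.splits)

text \<open>At the non-position \<open>(0, 0)\<close> the equation yields the value 0, which no other value uses.\<close>

function grundy :: "nat \<times> nat \<Rightarrow> nat" where
  "grundy p = mex (grundy ` moves p)"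
  by auto
termination
  by (relation "measure (\<lambda>p. fst p + snd p)") (auto dest: moves_less)

declare grundy.simps [simp del]

end

theory Submission
  imports Defs
begin

text \<open>In row \<open>a\<close> every value \<open>v\<close> has been used before column \<open>v + a + 1\<close>: each column in which it is
  not taken is either blocked by one of the \<open>a\<close> earlier rows, once per row, or takes a smaller value.
  Also \<open>\<G>(a, b) \<le> a + b\<close>. So, relative to \<open>b\<close>, the set of values used before column \<open>b\<close> is
  determined by its trace on a window of fixed length, which has finitely many states. The row thus
  runs a finite automaton whose input, the earlier rows, is ultimately additively periodic by
  induction; a repeated state gives the period.\<close>

lemma mex_notin: "finite S \<Longrightarrow> mex S \<notin> S"
  unfolding mex_def by (rule LeastI_ex) (rule ex_new_if_finite, auto)

lemma less_mex_in: "v < mex S \<Longrightarrow> v \<in> S"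
  unfolding mex_def using not_less_Least by blast

lemma finite_moves: "finite (moves p)"
proof -
  obtain a b where "p = (a, b)" by fastforce
  then have "moves p \<subseteq> {..a} \<times> {..b}"
    by (auto simp: moves_def)
  then show ?thesis
    by (rule finite_subset) simp
qed

lemma grundy_neq_move: "q \<in> moves p \<Longrightarrow> grundy q \<noteq> grundy p"
  by (metis finite_imageI finite_moves grundy.simps imageI mex_notin)

lemma less_grundy_move: "v < grundy p \<Longrightarrow> \<exists>q \<in> moves p. grundy q = v"
  by (metis grundy.simps imageE less_mex_in)

text \<open>Each move lowers the coordinate sum, so by induction no option attains the value
  \<open>fst p + snd p\<close>, and the mex cannot pass it.\<close>

lemma grundy_le: "grundy p \<le> fst p + snd p"
proof (induction "fst p + snd p" arbitrary: p rule: less_induct)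
  case less
  show ?case
  proof (rule ccontr)
    assume "\<not> grundy p \<le> fst p + snd p"
    then obtain q where q: "q \<in> moves p" "grundy q = fst p + snd p"
      using less_grundy_move[of "fst p + snd p" p] by auto
    then show False
      using less[of q] moves_less[of q p] by simp
  qed
qed

text \<open>The first position is an option of the second. The side condition excludes
  \<open>(0, 0)\<close>, whose default value 0 equals \<open>grundy (0, 1)\<close>.\<close>

lemma grundy_row_neq: "x < y \<Longrightarrow> (i, x) \<noteq> (0, 0) \<Longrightarrow> grundy (i, x) \<noteq> grundy (i, y)"
  by (rule grundy_neq_move) (auto simp: moves_def)

text \<open>With \<open>(0, 0)\<close> forbidden, square 1 is terminal, so the token moves like a
  Nim heap of size \<open>b\<close>.\<close>

lemma grundy_row_0: "grundy (0, Suc b) = b"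
proof (induction b rule: less_induct)
  case (less b)
  have "\<not> b < grundy (0, Suc b)"
  proof
    assume "b < grundy (0, Suc b)"
    then obtain q where move: "q \<in> moves (0, Suc b)" and q: "grundy q = b"
      using less_grundy_move by blast
    from move obtain y where "q = (0, y)" "0 < y" "y < Suc b"
      by (auto simp: moves_def)
    then obtain x where "q = (0, Suc x)" "x < b"
      by (cases y) simp_all
    with q less[of x] show False by simp
  qed
  moreover have "\<not> grundy (0, Suc b) < b"
  proof
    assume "grundy (0, Suc b) < b"
    with less[OF this] show False
      using grundy_row_neq[of "Suc (grundy (0, Suc b))" "Suc b" 0] by simp
  qed
  ultimately show ?case by simp
qed

lemma card_le_1_if_unique: "(\<And>x y. x \<in> A \<Longrightarrow> y \<in> A \<Longrightarrow> x = y) \<Longrightarrow> card A \<le> 1"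
  by (metis One_nat_def card_le_Suc0_iff_eq card.infinite zero_le_one)

lemma unused_value_bound:
  assumes "a > 0" and unused: "v \<notin> (\<lambda>x. grundy (a, x)) ` {..<b}"
  shows "b \<le> v + a"
proof -
  define L where "L = {x. x < b \<and> grundy (a, x) < v}"
  define B where "B i = {x. x < b \<and> (i, x) \<noteq> (0, 0) \<and> grundy (i, x) = v}" for i :: nat
  have "x \<in> L \<union> (\<Union>i<a. B i)" if "x < b" for x
  proof (cases "grundy (a, x) < v")
    case False
    with unused that have "v < grundy (a, x)"
      by force
    then obtain q where "q \<in> moves (a, x)" "grundy q = v"
      using less_grundy_move by blast
    with unused that show ?thesis
      by (auto simp: moves_def B_def)
  qed (use that in \<open>simp add: L_def\<close>)
  then have sub: "{..<b} \<subseteq> L \<union> (\<Union>i<a. B i)"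
    by auto
  have "inj_on (\<lambda>x. grundy (a, x)) L"
    using \<open>a > 0\<close> grundy_row_neq by (intro linorder_inj_onI') auto
  then have cL: "card L \<le> v"
    using card_inj_on_le[of "\<lambda>x. grundy (a, x)" L "{..<v}"] by (auto simp: L_def)
  have cB: "card (B i) \<le> 1" for i
    by (rule card_le_1_if_unique) (metis (mono_tags, lifting) B_def grundy_row_neq mem_Collect_eq nat_neq_iff)
  have "b \<le> card (L \<union> (\<Union>i<a. B i))"
    using card_mono[OF _ sub] by (simp add: L_def B_def)
  also have "\<dots> \<le> card L + card (\<Union>i<a. B i)"
    by (rule card_Un_le)
  also have "card (\<Union>i<a. B i) \<le> (\<Sum>i<a. card (B i))"
    by (rule card_UN_le) simp
  also have "(\<Sum>i<a. card (B i)) \<le> a"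
    using sum_bounded_above[of "{..<a}" "\<lambda>i. card (B i)" 1] cB by simp
  finally show ?thesis
    using cL by linarith
qed

text \<open>Abstracts one row: \<open>P b\<close> stands for the values of the earlier rows in
  column \<open>b\<close>. The conclusion \<open>p dvd q\<close> lets those rows share the new
  period.\<close>

lemma greedy_sequence_additively_periodic:
  fixes f :: "nat \<Rightarrow> nat" and P :: "nat \<Rightarrow> nat set"
  assumes new: "\<And>b. b \<ge> n \<Longrightarrow> f b \<notin> f ` {..<b} \<union> P b"
    and least: "\<And>b v. b \<ge> n \<Longrightarrow> v < f b \<Longrightarrow> v \<in> f ` {..<b} \<union> P b"
    and lower: "\<And>b v. v \<notin> f ` {..<b} \<Longrightarrow> b \<le> v + a"
    and upper: "\<And>b. f b \<le> b + a"
    and P: "\<And>b v. b \<ge> n \<Longrightarrow> v + p \<in> P (b + p) \<longleftrightarrow> v \<in> P b"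
    and "p \<ge> 1"
  shows "\<exists>m q. q \<ge> 1 \<and> p dvd q \<and> (\<forall>b \<ge> m. f (b + q) = f b + q)"
proof -
  \<comment> \<open>The window: offset \<open>i\<close> encodes the value \<open>b + i - a\<close>.
    The shift by \<open>a\<close> keeps offsets nonnegative, since by \<open>lower\<close> all
    values below \<open>b - a\<close> are used.\<close>
  define S where "S b = {i. b + i \<in> (\<lambda>x. f x + a) ` {..<b}}" for b
  define N where "N = n + a"
  have "i < 2 * a" if "i \<in> S b" for i b
  proof -
    from that obtain x where "x < b" "b + i = f x + a"
      by (auto simp: S_def)
    with upper[of x] show ?thesis by linarith
  qed
  \<comment> \<open>Pigeonhole on the states, sampled only every \<open>p\<close> columns so that
    the distance between equal states is a multiple of \<open>p\<close>.\<close>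
  then have "range (\<lambda>k. S (N + k * p)) \<subseteq> Pow {..<2 * a}"
    by auto
  then have "finite (range (\<lambda>k. S (N + k * p)))"
    by (rule finite_subset) simp
  then have "\<not> inj (\<lambda>k. S (N + k * p))"
    using finite_imageD infinite_UNIV_nat by blast
  then obtain k l where "k < l" and S_eq: "S (N + k * p) = S (N + l * p)"
    by (metis (mono_tags, lifting) linorder_injI)
  define m where "m = N + k * p"
  define q where "q = (l - k) * p"
  have "N + l * p = m + q"
    using \<open>k < l\<close> by (simp add: m_def q_def flip: add_mult_distrib)
  with S_eq have S_m: "S (m + q) = S m"
    by (simp add: m_def)
  have P_mult: "v + j * p \<in> P (b + j * p) \<longleftrightarrow> v \<in> P b" if "b \<ge> n" for b v j
  proof (induction j)
    case (Suc j)
    have "v + Suc j * p \<in> P (b + Suc j * p) \<longleftrightarrow> (v + j * p) + p \<in> P ((b + j * p) + p)"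
      by (simp add: ac_simps)
    also have "\<dots> \<longleftrightarrow> v \<in> P b"
      using P[of "b + j * p"] Suc that by simp
    finally show ?case .
  qed simp
  have used_iff: "v \<in> f ` {..<b} \<longleftrightarrow> v + a < b \<or> b \<le> v + a \<and> v + a - b \<in> S b" for v b
  proof (cases "v + a < b")
    case True
    then show ?thesis using lower[of v b] by linarith
  qed (auto simp: S_def image_iff)
  have step: "f (b + q) = f b + q"
    if "b \<ge> m" and U: "\<And>v. v + q \<in> f ` {..<b + q} \<longleftrightarrow> v \<in> f ` {..<b}" for b
  proof -
    have b: "b \<ge> n" "b \<ge> a"
      using that by (auto simp: m_def N_def)
    have A: "v + q \<in> f ` {..<b + q} \<union> P (b + q) \<longleftrightarrow> v \<in> f ` {..<b} \<union> P b" for v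
      using U[of v] P_mult[OF b(1), of v "l - k"] by (simp add: q_def)
    have "\<not> f b + q < f (b + q)"
      using least[of "b + q" "f b + q"] A[of "f b"] new[of b] b by auto
    moreover have "\<not> f (b + q) < f b + q"
    proof
      assume less: "f (b + q) < f b + q"
      show False
      \<comment> \<open>The equivalence \<open>A\<close> covers only values of the form
        \<open>v + q\<close>. Values below \<open>q\<close> are excluded by \<open>lower\<close>,
        because \<open>b \<ge> a\<close>.\<close>
      proof (cases "f (b + q) < q")
        case True
        then show False
          using lower[of "f (b + q)" "b + q"] new[of "b + q"] b by auto
      next
        case False
        then have "f (b + q) = (f (b + q) - q) + q" "f (b + q) - q < f b"
          using less by auto
        then show False
          using A least new[of "b + q"] b by (metis trans_le_add1)
      qed
    qed
    ultimately show ?thesis by linarith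
  qed
  \<comment> \<open>Equal states start the induction; each further column adds
    \<open>f (m + j)\<close> to one used set and its shift by \<open>q\<close> to the other.\<close>
  have used_shift: "v + q \<in> f ` {..<m + j + q} \<longleftrightarrow> v \<in> f ` {..<m + j}" for v j
  proof (induction j arbitrary: v)
    case 0
    show ?case
      using S_m by (auto simp: used_iff add.commute add.left_commute)
  next
    case (Suc j)
    have "f (m + j + q) = f (m + j) + q"
      using step[of "m + j"] Suc by simp
    then show ?case
      using Suc[of v] by (simp add: lessThan_Suc)
  qed
  have "f (b + q) = f b + q" if "b \<ge> m" for b
    using step[OF that] used_shift[of _ "b - m"] that by simp
  moreover have "q \<ge> 1" "p dvd q"
    using \<open>k < l\<close> \<open>p \<ge> 1\<close> by (auto simp: q_def)
  ultimately show ?thesis by blast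
qed

lemma additively_periodic_mult:
  fixes f :: "nat \<Rightarrow> nat"
  assumes "\<And>b. b \<ge> n \<Longrightarrow> f (b + p) = f b + p" "b \<ge> n"
  shows "f (b + k * p) = f b + k * p"
proof (induction k)
  case (Suc k)
  then show ?case
    using assms(1)[of "b + k * p"] assms(2) by (simp add: ac_simps)
qed simp

text \<open>Treats all rows up to \<open>a\<close> at once, because the next row reads all of them
  and needs one period for its input.\<close>

lemma rows_common_period:
  "\<exists>n p. p \<ge> 1 \<and> (\<forall>i \<le> a. \<forall>b \<ge> n. grundy (i, b + p) = grundy (i, b) + p)"
proof (induction a)
  case 0
  \<comment> \<open>The default value at \<open>(0, 0)\<close> breaks the shift at
    \<open>b = 0\<close>.\<close>
  have "grundy (0, b + 1) = grundy (0, b) + 1" if "b \<ge> 1" for b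
    using that grundy_row_0[of b] grundy_row_0[of "b - 1"] by simp
  then show ?case by (metis le_zero_eq order_refl)
next
  case (Suc a)
  then obtain n p where "p \<ge> 1"
    and per: "\<And>i b. i \<le> a \<Longrightarrow> b \<ge> n \<Longrightarrow> grundy (i, b + p) = grundy (i, b) + p"
    by blast
  let ?f = "\<lambda>b. grundy (Suc a, b)" and ?P = "\<lambda>b. (\<lambda>i. grundy (i, b)) ` {..a}"
  have moves: "grundy ` moves (Suc a, b) = ?f ` {..<b} \<union> ?P b" if "b \<ge> Suc n" for b
  proof -
    have "moves (Suc a, b) = Pair (Suc a) ` {..<b} \<union> (\<lambda>i. (i, b)) ` {..a}"
      using that by (auto simp: moves_def)
    then show ?thesis by (simp add: image_Un image_image)
  qed
  have "\<exists>m q. q \<ge> 1 \<and> p dvd q \<and> (\<forall>b \<ge> m. ?f (b + q) = ?f b + q)"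
  proof (rule greedy_sequence_additively_periodic[where n = "Suc n" and a = "Suc a" and P = ?P])
    show "?f b \<notin> ?f ` {..<b} \<union> ?P b" if "b \<ge> Suc n" for b
      using grundy_neq_move moves[OF that] by (metis imageE)
    show "v \<in> ?f ` {..<b} \<union> ?P b" if "b \<ge> Suc n" "v < ?f b" for b v
      using less_grundy_move[OF that(2)] moves[OF that(1)] by blast
    show "b \<le> v + Suc a" if "v \<notin> ?f ` {..<b}" for b v
      using unused_value_bound that by blast
    show "?f b \<le> b + Suc a" for b
      using grundy_le[of "(Suc a, b)"] by simp
    show "v + p \<in> ?P (b + p) \<longleftrightarrow> v \<in> ?P b" if "b \<ge> Suc n" for b v
      using that per by (auto simp: image_iff)
  qed fact
  then obtain m q where "q \<ge> 1" "p dvd q" and row: "\<And>b. b \<ge> m \<Longrightarrow> ?f (b + q) = ?f b + q"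
    by blast
  then obtain k where q: "q = k * p"
    by (metis dvdE mult.commute)
  have "grundy (i, b + q) = grundy (i, b) + q" if "i \<le> Suc a" "b \<ge> max m n" for i b
  proof (cases "i = Suc a")
    case False
    then show ?thesis
      using additively_periodic_mult[of n "\<lambda>b. grundy (i, b)" p b k] per that q by simp
  qed (use row that in simp)
  with \<open>q \<ge> 1\<close> show ?case by blast
qed

theorem theorem5:
  fixes a :: nat
  assumes "a > 0"
  shows "\<exists>n\<^sub>0 \<ge> a. \<exists>p \<ge> 1. \<forall>b \<ge> n\<^sub>0. grundy (a, b + p) = grundy (a, b) + p"
proof -
  obtain n p where "p \<ge> 1" and "\<And>b. b \<ge> n \<Longrightarrow> grundy (a, b + p) = grundy (a, b) + p"
    using rows_common_period[of a] by blast
  then show ?thesis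
    by (intro exI[of _ "max a n"] conjI exI[of _ p]) auto
qed

end
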